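(* For every integer $v>5$ with $v\equiv 2 \pmod 6$ there exists a simple $3-\bigl(2v,5,\tfrac34(v-2)(v-4)\bigr)$ design.
   Context: A $t-(v,k,\lambda)$ design is a pair $(X,\mathcal B)$ with $|X|=v$ and $\mathcal B$ a collection of $k$-subsets (blocks) of $X$ such that every $t$-subset of $X$ is contained in exactly $\lambda$ blocks. It is simple if it has no repeated blocks. *)

theory Defs
  imports Complex_Main "HOL-Library.Multiset"
begin

text \<open>
  The collection of blocks is a multiset, so that repeated blocks are permitted in general and
  simplicity is a genuine condition.
\<close>

definition t_design ::
  "nat \<Rightarrow> nat \<Rightarrow> nat \<Rightarrow> nat \<Rightarrow> 'a set \<Rightarrow> 'a set multiset \<Rightarrow> bool" where
  "t_design t v k lam X \<B> \<longleftrightarrow>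
     finite X \<and> card X = v \<and>
     (\<forall>B\<in>#\<B>. B \<subseteq> X \<and> card B = k) \<and>
     (\<forall>T. T \<subseteq> X \<and> card T = t \<longrightarrow> size {#B \<in># \<B>. T \<subseteq> B#} = lam)"

definition no_repeated_blocks :: "'a set multiset \<Rightarrow> bool" where
  "no_repeated_blocks \<B> \<longleftrightarrow> (\<forall>B\<in>#\<B>. count \<B> B = 1)"

definition simple_t_design ::
  "nat \<Rightarrow> nat \<Rightarrow> nat \<Rightarrow> nat \<Rightarrow> 'a set \<Rightarrow> 'a set multiset \<Rightarrow> bool" where
  "simple_t_design t v k lam X \<B> \<longleftrightarrow> t_design t v k lam X \<B> \<and> no_repeated_blocks \<B>"

end

theory Submission
  imports Defs "HOL-Number_Theory.Cong"
begin

text \<open>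
  Write \<open>v = 2 m + 2\<close> and \<open>n = v - 1 = 2 m + 1\<close>, so that \<open>lam = 3 m (m - 1)\<close> and \<open>n\<close> is prime to 6.
  The points form two disjoint halves of size \<open>v\<close>. All 5-subsets of either half are blocks, and
  the other blocks are unions \<open>T \<union> P\<close> of a triple in one half and a pair in the other.

  Colour triples and pairs by \<open>n\<close> colours. For the pairs, every class is a perfect matching (a
  one-factorization of the complete graph); for the triples, every class is a 1-design in which
  each point has degree \<open>m\<close>. Let \<open>T \<union> P\<close> be a block when the two colours are related by a fixed
  relation in which each colour has exactly \<open>m - 1\<close> partners on either side. Then a triple inside
  a half lies in \<open>(2 m - 1) (m - 1)\<close> blocks of that half, since these are counted by the pairs of
  the remaining \<open>2 m - 1\<close> points, and in \<open>(m - 1) (m + 1)\<close> mixed blocks, since each colour occurs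
  on \<open>m + 1\<close> pairs. Two points \<open>x, y\<close> of one half and a point \<open>z\<close> of the other lie together in
  \<open>2 m (m - 1)\<close> blocks whose triple contains \<open>x, y\<close> (choose the third point, then one of
  \<open>m - 1\<close> colours; the pair through \<open>z\<close> is then forced) and in \<open>(m - 1) m\<close> blocks whose triple
  contains \<open>z\<close>. Both totals are \<open>3 m (m - 1)\<close>. This is \<open>doubled_design\<close>.

  The colourings live on the integers modulo \<open>n\<close> with one extra point \<open>\<infinity>\<close>. The pair \<open>{a, b}\<close>
  gets the colour \<open>a + b\<close>, and \<open>{\<infinity>, a}\<close> gets \<open>2 a\<close>: the classical one-factorization. A triple
  is coloured by 6 times its centre of gravity, where \<open>\<infinity>\<close> carries no weight: \<open>2 (a + b + c)\<close> for
  \<open>{a, b, c}\<close> and \<open>3 (a + b)\<close> for \<open>{\<infinity>, a, b}\<close>. This is where \<open>v mod 6 = 2\<close> enters: centres of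
  gravity require 2 and 3 to be invertible modulo \<open>n\<close>. Fix a centre \<open>q\<close>. The triples
  through \<open>\<infinity>\<close> centred at \<open>q\<close> are the \<open>m\<close> pairs with midpoint \<open>q\<close>. A finite point
  \<open>x \<noteq> q\<close> is in \<open>m - 1\<close> finite triples centred at \<open>q\<close> and in one that contains \<open>\<infinity>\<close>, whereas
  \<open>q\<close> itself is in \<open>m\<close> finite ones and in none with \<open>\<infinity>\<close>. So every degree is \<open>m\<close>; this is
  \<open>triple_colour_balanced\<close>.
\<close>

section \<open>Counting\<close>

lemma card_supersets:
  assumes "finite X" "A \<subseteq> X"
  shows "card {S. S \<subseteq> X \<and> card S = k + card A \<and> A \<subseteq> S \<and> P S} =
         card {S. S \<subseteq> X - A \<and> card S = k \<and> P (A \<union> S)}"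
proof (rule bij_betw_same_card [of "\<lambda>S. S - A"])
  have fA: "finite A" using assms finite_subset by blast
  show "bij_betw (\<lambda>S. S - A) {S. S \<subseteq> X \<and> card S = k + card A \<and> A \<subseteq> S \<and> P S}
          {S. S \<subseteq> X - A \<and> card S = k \<and> P (A \<union> S)}"
  proof (rule bij_betw_byWitness [where f' = "\<lambda>S. A \<union> S"])
    show "(\<lambda>S. S - A) ` {S. S \<subseteq> X \<and> card S = k + card A \<and> A \<subseteq> S \<and> P S}
            \<subseteq> {S. S \<subseteq> X - A \<and> card S = k \<and> P (A \<union> S)}"
      using fA by (auto simp: card_Diff_subset Un_absorb1)
    show "(\<lambda>S. A \<union> S) ` {S. S \<subseteq> X - A \<and> card S = k \<and> P (A \<union> S)}
            \<subseteq> {S. S \<subseteq> X \<and> card S = k + card A \<and> A \<subseteq> S \<and> P S}"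
    proof clarify
      fix S assume S: "S \<subseteq> X - A" "P (A \<union> S)" "k = card S"
      have "card (A \<union> S) = card A + card S"
        using S fA assms finite_subset[of S X] by (intro card_Un_disjoint) auto
      then show "A \<union> S \<subseteq> X \<and> card (A \<union> S) = card S + card A \<and> A \<subseteq> A \<union> S \<and> P (A \<union> S)"
        using S assms by auto
    qed
  qed auto
qed

lemma card_star:
  assumes "finite X" "x \<in> X"
  shows "card {S. S \<subseteq> X \<and> card S = Suc k \<and> x \<in> S \<and> P S} =
         card {S. S \<subseteq> X - {x} \<and> card S = k \<and> P (insert x S)}"
  using card_supersets[of X "{x}" k P] assms by simp

lemma card_star_pairs:
  assumes "finite X" "x \<in> X"
  shows "card {S. S \<subseteq> X \<and> card S = 2 \<and> x \<in> S \<and> P S} = card {y \<in> X - {x}. P {x, y}}"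
proof -
  have "card {S. S \<subseteq> X - {x} \<and> card S = 1 \<and> P (insert x S)} = card {y \<in> X - {x}. P {x, y}}"
    by (rule bij_betw_same_card[symmetric, of "\<lambda>y. {y}"])
       (auto simp: bij_betw_def inj_on_def card_1_singleton_iff)
  then show ?thesis
    using card_star[OF assms, of 1 P] by (simp add: numeral_2_eq_2)
qed

lemma card_fixed_superset:
  assumes "finite X" "A \<subseteq> X"
  shows "card {S. S \<subseteq> X \<and> card S = card A \<and> A \<subseteq> S \<and> P S} = (if P A then 1 else 0)"
proof -
  have "{S. S \<subseteq> X \<and> card S = card A \<and> A \<subseteq> S \<and> P S} = (if P A then {A} else {})"
    using assms card_subset_eq[OF finite_subset[OF _ assms(1)]] by (auto, metis+)
  then show ?thesis by simp
qed

text \<open>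
  Double counting of the incidences between points and members of a uniform family.
\<close>

lemma sum_degrees:
  assumes "finite X" "\<And>S. S \<in> F \<Longrightarrow> S \<subseteq> X \<and> card S = k"
  shows "(\<Sum>x\<in>X. card {S \<in> F. x \<in> S}) = k * card F"
proof -
  have "finite F" using assms by (intro finite_subset[of F "Pow X"]) auto
  have "\<forall>S\<in>F. card {x \<in> X. x \<in> S} = k"
  proof
    fix S assume "S \<in> F"
    then have "{x \<in> X. x \<in> S} = S" using assms(2) by auto
    then show "card {x \<in> X. x \<in> S} = k" using assms(2) \<open>S \<in> F\<close> by simp
  qed
  then show ?thesis
    using sum_multicount[of X F "\<lambda>x S. x \<in> S" k] assms(1) \<open>finite F\<close> by simp
qed

section \<open>Balanced colourings\<close>

text \<open>
  Each colour class of \<open>k\<close>-subsets is to form a 1-design in which every point has degree \<open>r\<close>.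
  With \<open>k = 2\<close> and \<open>r = 1\<close> this is a one-factorization of the complete graph on \<open>X\<close>.
\<close>

definition balanced_colouring ::
  "'a set \<Rightarrow> 'c set \<Rightarrow> nat \<Rightarrow> nat \<Rightarrow> ('a set \<Rightarrow> 'c) \<Rightarrow> bool" where
  "balanced_colouring X C k r f \<longleftrightarrow>
     (\<forall>S. S \<subseteq> X \<and> card S = k \<longrightarrow> f S \<in> C) \<and>
     (\<forall>x\<in>X. \<forall>c\<in>C. card {S. S \<subseteq> X \<and> card S = k \<and> x \<in> S \<and> f S = c} = r)"

lemma balanced_colouring_class_size:
  assumes "balanced_colouring X C k r f" "finite X" "c \<in> C"
  shows "k * card {S. S \<subseteq> X \<and> card S = k \<and> f S = c} = card X * r"
proof -
  have "k * card {S. S \<subseteq> X \<and> card S = k \<and> f S = c} =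
        (\<Sum>x\<in>X. card {S \<in> {S. S \<subseteq> X \<and> card S = k \<and> f S = c}. x \<in> S})"
    using assms(2) by (intro sum_degrees[symmetric]) auto
  also have "\<dots> = (\<Sum>x\<in>X. r)"
  proof (rule sum.cong)
    fix x assume "x \<in> X"
    have "{S \<in> {S. S \<subseteq> X \<and> card S = k \<and> f S = c}. x \<in> S} =
          {S. S \<subseteq> X \<and> card S = k \<and> x \<in> S \<and> f S = c}" by auto
    then show "card {S \<in> {S. S \<subseteq> X \<and> card S = k \<and> f S = c}. x \<in> S} = r"
      using assms(1,3) \<open>x \<in> X\<close> by (simp add: balanced_colouring_def)
  qed simp
  finally show ?thesis by simp
qed

lemma balanced_colouring_transfer:
  assumes bal: "balanced_colouring X C k r f" and bij: "bij_betw \<phi> Y X"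
  shows "balanced_colouring Y C k r (\<lambda>S. f (\<phi> ` S))"
proof -
  have inj: "inj_on \<phi> Y" and img: "\<phi> ` Y = X" using bij by (auto simp: bij_betw_def)
  have card_img: "card (\<phi> ` S) = card S" if "S \<subseteq> Y" for S
    using inj that by (meson card_image inj_on_subset)
  have "card {S. S \<subseteq> Y \<and> card S = k \<and> y \<in> S \<and> f (\<phi> ` S) = c} = r"
    if "y \<in> Y" "c \<in> C" for y c
  proof -
    have "bij_betw (image \<phi>) {S. S \<subseteq> Y \<and> card S = k \<and> y \<in> S \<and> f (\<phi> ` S) = c}
            {S. S \<subseteq> X \<and> card S = k \<and> \<phi> y \<in> S \<and> f S = c}"
      unfolding bij_betw_def
    proof
      show "inj_on (image \<phi>) {S. S \<subseteq> Y \<and> card S = k \<and> y \<in> S \<and> f (\<phi> ` S) = c}"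
        using inj_on_image_Pow[OF inj] by (rule inj_on_subset) auto
      show "image \<phi> ` {S. S \<subseteq> Y \<and> card S = k \<and> y \<in> S \<and> f (\<phi> ` S) = c} =
            {S. S \<subseteq> X \<and> card S = k \<and> \<phi> y \<in> S \<and> f S = c}"
      proof (intro equalityI subsetI)
        fix T assume T: "T \<in> {S. S \<subseteq> X \<and> card S = k \<and> \<phi> y \<in> S \<and> f S = c}"
        then obtain S where S: "S \<subseteq> Y" "T = \<phi> ` S"
          using img by (auto simp: subset_image_iff)
        moreover have "y \<in> S"
          using T S inj \<open>y \<in> Y\<close> by (simp add: inj_on_image_mem_iff)
        ultimately show
          "T \<in> image \<phi> ` {S. S \<subseteq> Y \<and> card S = k \<and> y \<in> S \<and> f (\<phi> ` S) = c}"
          using T card_img by auto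
      qed (use img card_img in auto)
    qed
    then show ?thesis
      using bal that img by (auto simp: balanced_colouring_def dest: bij_betw_same_card)
  qed
  moreover have "f (\<phi> ` S) \<in> C" if "S \<subseteq> Y" "card S = k" for S
    using bal card_img[OF that(1)] that image_mono[OF that(1), of \<phi>] img
    by (simp add: balanced_colouring_def)
  ultimately show ?thesis by (auto simp: balanced_colouring_def)
qed

lemma card_colours_in:
  assumes "finite X" "finite D"
    and "\<And>c. c \<in> D \<Longrightarrow> card {S. S \<subseteq> X \<and> Q S \<and> f S = c} = r"
  shows "card {S. S \<subseteq> X \<and> Q S \<and> f S \<in> D} = card D * r"
proof -
  have "{S. S \<subseteq> X \<and> Q S \<and> f S \<in> D} = (\<Union>c\<in>D. {S. S \<subseteq> X \<and> Q S \<and> f S = c})" by auto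
  also have "card \<dots> = (\<Sum>c\<in>D. card {S. S \<subseteq> X \<and> Q S \<and> f S = c})"
    using assms(1,2) by (intro card_UN_disjoint) auto
  also have "\<dots> = card D * r" using assms(3) by simp
  finally show ?thesis .
qed

section \<open>Doubling\<close>

definition crossing_blocks ::
  "'a set \<Rightarrow> 'a set \<Rightarrow> ('a set \<Rightarrow> 'c) \<Rightarrow> ('a set \<Rightarrow> 'c) \<Rightarrow> ('c \<times> 'c) set \<Rightarrow> 'a set set" where
  "crossing_blocks X Y g h R =
     {S. S \<subseteq> X \<union> Y \<and> card (S \<inter> X) = 3 \<and> card (S \<inter> Y) = 2 \<and> (g (S \<inter> X), h (S \<inter> Y)) \<in> R}"

lemma card_crossing_blocks_containing:
  assumes "finite X" "finite Y" "X \<inter> Y = {}" "A \<subseteq> X" "B \<subseteq> Y"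
  shows "card {S \<in> crossing_blocks X Y g h R. A \<union> B \<subseteq> S} =
    card (SIGMA U : {U. U \<subseteq> X \<and> card U = 3 \<and> A \<subseteq> U}.
                    {V. V \<subseteq> Y \<and> (card V = 2 \<and> B \<subseteq> V) \<and> (g U, h V) \<in> R})"
    (is "card ?L = card ?P")
proof (rule bij_betw_same_card)
  have split: "(U \<union> V) \<inter> X = U" "(U \<union> V) \<inter> Y = V" if "U \<subseteq> X" "V \<subseteq> Y" for U V
    using that assms(3) by auto
  show "bij_betw (\<lambda>S. (S \<inter> X, S \<inter> Y)) ?L ?P"
  proof (rule bij_betw_byWitness[where f' = "\<lambda>(U, V). U \<union> V"])
    show "(\<lambda>S. (S \<inter> X, S \<inter> Y)) ` ?L \<subseteq> ?P"
      using assms by (auto simp: crossing_blocks_def)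
    show "(\<lambda>(U, V). U \<union> V) ` ?P \<subseteq> ?L"
      by (auto simp: crossing_blocks_def split)
  qed (auto simp: crossing_blocks_def split)
qed

text \<open>
  The blocks containing \<open>A \<union> B\<close> are counted by choosing the triple \<open>U \<supseteq> A\<close> first and
  then a pair \<open>V \<supseteq> B\<close> in one of the \<open>u\<close> colours related to that of \<open>U\<close>. If \<open>B\<close> is empty, each colour
  offers its \<open>m + 1\<close> pairs; if \<open>B\<close> is a point, each colour offers exactly one. If \<open>B\<close> is itself
  the pair, the roles are exchanged: its colour admits \<open>u\<close> triple colours, each giving \<open>m\<close>
  triples through the point of \<open>A\<close>.
\<close>

lemma crossing_degree:
  fixes C :: "'c set"
  assumes fin: "finite X" "finite Y" "finite C" and disj: "X \<inter> Y = {}"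
    and card: "card X = 2 * m + 2" "card Y = 2 * m + 2"
    and g: "balanced_colouring X C 3 m g" and h: "balanced_colouring Y C 2 1 h"
    and row: "\<forall>c\<in>C. card {d \<in> C. (c, d) \<in> R} = u"
    and col: "\<forall>d\<in>C. card {c \<in> C. (c, d) \<in> R} = u"
    and sub: "A \<subseteq> X" "B \<subseteq> Y"
  shows "card A = 3 \<Longrightarrow> card B = 0 \<Longrightarrow>
           card {S \<in> crossing_blocks X Y g h R. A \<union> B \<subseteq> S} = u * (m + 1)"
    and "card A = 2 \<Longrightarrow> card B = 1 \<Longrightarrow>
           card {S \<in> crossing_blocks X Y g h R. A \<union> B \<subseteq> S} = 2 * m * u"
    and "card A = 1 \<Longrightarrow> card B = 2 \<Longrightarrow>
           card {S \<in> crossing_blocks X Y g h R. A \<union> B \<subseteq> S} = u * m"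
    and "card A = 0 \<Longrightarrow> card B = 3 \<Longrightarrow>
           card {S \<in> crossing_blocks X Y g h R. A \<union> B \<subseteq> S} = 0"
proof -
  define Us where "Us = {U. U \<subseteq> X \<and> card U = 3 \<and> A \<subseteq> U}"
  define Vs where "Vs U = {V. V \<subseteq> Y \<and> (card V = 2 \<and> B \<subseteq> V) \<and> (g U, h V) \<in> R}" for U
  have fUs: "finite Us" and fVs: "finite (Vs U)" for U
    using fin by (auto simp: Us_def Vs_def)
  have fAB: "finite A" "finite B" using sub fin finite_subset by blast+
  have gC: "g U \<in> C" if "U \<in> Us" for U
    using g that by (auto simp: balanced_colouring_def Us_def)
  have deg: "card {S \<in> crossing_blocks X Y g h R. A \<union> B \<subseteq> S} = (\<Sum>U\<in>Us. card (Vs U))"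
    using card_crossing_blocks_containing[OF fin(1,2) disj sub, of g h R]
      card_SigmaI[of Us Vs] fUs fVs by (simp add: Us_def Vs_def)
  have cardVs: "card (Vs U) = u * r"
    if "U \<in> Us"
      and "\<And>d. d \<in> C \<Longrightarrow> card {V. V \<subseteq> Y \<and> (card V = 2 \<and> B \<subseteq> V) \<and> h V = d} = r" for U r
  proof -
    have "Vs U = {V. V \<subseteq> Y \<and> (card V = 2 \<and> B \<subseteq> V) \<and> h V \<in> {d \<in> C. (g U, d) \<in> R}}"
      using h by (auto simp: Vs_def balanced_colouring_def)
    then show ?thesis
      using card_colours_in[of Y "{d \<in> C. (g U, d) \<in> R}" "\<lambda>V. card V = 2 \<and> B \<subseteq> V" h r]
        fin that(2) row gC[OF that(1)] by simp
  qed
  {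
    assume A: "card A = 3" and B: "card B = 0"
    have "Us = {A}"
      using A sub card_subset_eq[OF finite_subset[OF _ fin(1)]] by (auto simp: Us_def, metis+)
    moreover have "card (Vs A) = u * (m + 1)"
    proof (rule cardVs)
      show "A \<in> Us" using \<open>Us = {A}\<close> by simp
      show "card {V. V \<subseteq> Y \<and> (card V = 2 \<and> B \<subseteq> V) \<and> h V = d} = m + 1" if "d \<in> C" for d
        using balanced_colouring_class_size[OF h fin(2) that] B fAB card by simp
    qed
    ultimately show "card {S \<in> crossing_blocks X Y g h R. A \<union> B \<subseteq> S} = u * (m + 1)"
      using deg by simp
  }
  {
    assume A: "card A = 2" and B: "card B = 1"
    obtain z where z: "B = {z}" using B card_1_singletonE by blast
    have "card (Vs U) = u * 1" if "U \<in> Us" for U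
    proof (rule cardVs[OF that])
      show "card {V. V \<subseteq> Y \<and> (card V = 2 \<and> B \<subseteq> V) \<and> h V = d} = 1" if "d \<in> C" for d
        using h that z sub by (simp add: balanced_colouring_def)
    qed
    moreover have "card Us = 2 * m"
    proof -
      have "card Us = card {S. S \<subseteq> X - A \<and> card S = 1}"
        using card_supersets[OF fin(1) sub(1), of 1 "\<lambda>_. True"] A
        by (simp add: Us_def numeral_3_eq_3)
      also have "\<dots> = card (X - A) choose 1" using fin by (intro n_subsets) auto
      finally show ?thesis using A fAB sub card by (simp add: card_Diff_subset)
    qed
    ultimately show "card {S \<in> crossing_blocks X Y g h R. A \<union> B \<subseteq> S} = 2 * m * u"
      using deg by simp
  }
  {
    assume A: "card A = 1" and B: "card B = 2"
    obtain z where z: "A = {z}" using A card_1_singletonE by blast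
    have hB: "h B \<in> C" using h B sub by (simp add: balanced_colouring_def)
    have "(\<Sum>U\<in>Us. card (Vs U)) = (\<Sum>U\<in>Us. if (g U, h B) \<in> R then 1 else 0)"
    proof (rule sum.cong)
      fix U assume "U \<in> Us"
      show "card (Vs U) = (if (g U, h B) \<in> R then 1 else 0)"
        using card_fixed_superset[OF fin(2) sub(2), of "\<lambda>V. (g U, h V) \<in> R"] B
        by (simp add: Vs_def)
    qed simp
    also have "\<dots> = card {U \<in> Us. (g U, h B) \<in> R}"
      using fUs by (simp add: sum.If_cases Int_def)
    also have "{U \<in> Us. (g U, h B) \<in> R} =
               {U. U \<subseteq> X \<and> (card U = 3 \<and> z \<in> U) \<and> g U \<in> {c \<in> C. (c, h B) \<in> R}}"
      using gC z by (auto simp: Us_def)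
    also have "card \<dots> = u * m"
      using card_colours_in[of X "{c \<in> C. (c, h B) \<in> R}" "\<lambda>U. card U = 3 \<and> z \<in> U" g m]
        fin g z sub col hB by (simp add: balanced_colouring_def)
    finally show "card {S \<in> crossing_blocks X Y g h R. A \<union> B \<subseteq> S} = u * m"
      using deg by simp
  }
  {
    assume B: "card B = 3"
    have "\<not> B \<subseteq> V" if "V \<subseteq> Y" "card V = 2" for V
      using card_mono[of V B] that B finite_subset[OF that(1) fin(2)] by auto
    then have "Vs U = {}" for U by (auto simp: Vs_def)
    then show "card {S \<in> crossing_blocks X Y g h R. A \<union> B \<subseteq> S} = 0"
      using deg by simp
  }
qed

definition doubled_blocks where
  "doubled_blocks X Y g h g' h' R =
     {S. S \<subseteq> X \<and> card S = 5} \<union> {S. S \<subseteq> Y \<and> card S = 5} \<union>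
     crossing_blocks X Y g h R \<union> crossing_blocks Y X g' h' R"

lemma doubled_blocks_swap:
  "doubled_blocks X Y g h g' h' R = doubled_blocks Y X g' h' g h R"
  by (auto simp: doubled_blocks_def)

text \<open>
  The construction is symmetric in its halves, so a triple of points can be assumed to have at
  most one point in \<open>Y\<close>. What remains is to add up the contributions of the four kinds of blocks.
\<close>

lemma doubled_degree:
  fixes C :: "'c set"
  assumes fin: "finite X" "finite Y" "finite C" and disj: "X \<inter> Y = {}"
    and card: "card X = 2 * m + 2" "card Y = 2 * m + 2"
    and g: "balanced_colouring X C 3 m g" and h: "balanced_colouring Y C 2 1 h"
    and g': "balanced_colouring Y C 3 m g'" and h': "balanced_colouring X C 2 1 h'"
    and row: "\<forall>c\<in>C. card {d \<in> C. (c, d) \<in> R} = m - 1"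
    and col: "\<forall>d\<in>C. card {c \<in> C. (c, d) \<in> R} = m - 1"
    and T: "T \<subseteq> X \<union> Y" "card T = 3" "card (T \<inter> Y) \<le> 1"
  shows "card {S \<in> doubled_blocks X Y g h g' h' R. T \<subseteq> S} = 3 * m * (m - 1)"
proof -
  define A B where "A = T \<inter> X" and "B = T \<inter> Y"
  have fT: "finite T" using T(2) card_gt_0_iff[of T] by simp
  have AB: "A \<subseteq> X" "B \<subseteq> Y" "T = A \<union> B" "T = B \<union> A" "finite A" "finite B"
    using T(1) fT unfolding A_def B_def by blast+
  have "A \<inter> B = {}" using disj unfolding A_def B_def by blast
  then have cAB: "card A + card B = 3"
    using card_Un_disjoint[of A B] AB(3,5,6) T(2) by simp
  define F where "F Z = {S. S \<subseteq> Z \<and> card S = 5 \<and> T \<subseteq> S}" for Z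
  define K where "K = {S \<in> crossing_blocks X Y g h R. T \<subseteq> S}"
  define K' where "K' = {S \<in> crossing_blocks Y X g' h' R. T \<subseteq> S}"
  have finF: "finite (F X)" "finite (F Y)" using fin by (auto simp: F_def)
  have "K \<subseteq> Pow (X \<union> Y)" "K' \<subseteq> Pow (X \<union> Y)"
    unfolding K_def K'_def crossing_blocks_def by blast+
  then have finK: "finite K" "finite K'"
    using fin finite_subset[of _ "Pow (X \<union> Y)"] by auto
  have KK': "K \<inter> K' = {}" by (auto simp: K_def K'_def crossing_blocks_def)
  have FK: "(F X \<union> F Y) \<inter> (K \<union> K') = {}"
  proof -
    have "S \<inter> X = {} \<or> S \<inter> Y = {}" if "S \<in> F X \<union> F Y" for S
      using that disj unfolding F_def by blast
    moreover have "S \<inter> X \<noteq> {} \<and> S \<inter> Y \<noteq> {}" if "S \<in> K \<union> K'" for S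
      using that by (auto simp: K_def K'_def crossing_blocks_def)
    ultimately show ?thesis by blast
  qed
  have FF: "F X \<inter> F Y = {}"
  proof (rule equals0I)
    fix S assume "S \<in> F X \<inter> F Y"
    then have "S \<subseteq> X \<inter> Y" "card S = 5" by (auto simp: F_def)
    then show False using disj by simp
  qed
  have "{S \<in> doubled_blocks X Y g h g' h' R. T \<subseteq> S} = (F X \<union> F Y) \<union> (K \<union> K')"
    unfolding doubled_blocks_def F_def K_def K'_def by blast
  then have total: "card {S \<in> doubled_blocks X Y g h g' h' R. T \<subseteq> S} =
      card (F X) + card (F Y) + card K + card K'"
    using finF finK KK' FK FF by (simp add: card_Un_disjoint)
  note K = crossing_degree[OF fin disj card g h row col AB(1,2), folded AB(3), folded K_def]
  note K' = crossing_degree[OF fin(2,1,3) _ card(2,1) g' h' row col AB(2,1),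
      folded AB(4), folded K'_def]
  have disj': "Y \<inter> X = {}" using disj by auto
  consider "card B = 0" | "card B = 1" using T(3) unfolding B_def by linarith
  then show ?thesis
  proof cases
    case 1
    then have TX: "T = A" "T \<subseteq> X" "card A = 3" using AB cAB by auto
    have "card (F X) = card {S. S \<subseteq> X - T \<and> card S = 2}"
      using card_supersets[OF fin(1) TX(2), of 2 "\<lambda>_. True"] T by (simp add: F_def)
    also have "\<dots> = card (X - T) choose 2" using fin by (intro n_subsets) auto
    also have "card (X - T) = 2 * m - 1" using TX T card fT by (simp add: card_Diff_subset)
    also have "(2 * m - 1) choose 2 = (2 * m - 1) * (m - 1)"
      by (cases m) (auto simp: choose_two)
    finally have FX: "card (F X) = (2 * m - 1) * (m - 1)" .
    have "T \<noteq> {}" using T by auto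
    then have FY: "F Y = {}" using TX disj by (auto simp: F_def)
    have "(2 * m - 1) * (m - 1) + (m - 1) * (m + 1) = 3 * m * (m - 1)"
      by (cases m) (auto simp: algebra_simps)
    then show ?thesis
      using total FX FY K(1) K'(4)[OF disj'] 1 TX by simp
  next
    case 2
    then have "card A = 2" using cAB by simp
    then have "A \<noteq> {}" "B \<noteq> {}" using 2 by auto
    then have "F X = {}" "F Y = {}"
      using AB(1-3) disj unfolding F_def by blast+
    then show ?thesis
      using total K(2) K'(3)[OF disj'] 2 \<open>card A = 2\<close> by (simp add: algebra_simps)
  qed
qed

lemma doubled_design:
  fixes C :: "'c set"
  assumes fin: "finite X" "finite Y" "finite C" and disj: "X \<inter> Y = {}"
    and card: "card X = 2 * m + 2" "card Y = 2 * m + 2"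
    and g: "balanced_colouring X C 3 m g" and h: "balanced_colouring Y C 2 1 h"
    and g': "balanced_colouring Y C 3 m g'" and h': "balanced_colouring X C 2 1 h'"
    and row: "\<forall>c\<in>C. card {d \<in> C. (c, d) \<in> R} = m - 1"
    and col: "\<forall>d\<in>C. card {c \<in> C. (c, d) \<in> R} = m - 1"
  shows "simple_t_design 3 (2 * (2 * m + 2)) 5 (3 * m * (m - 1)) (X \<union> Y)
           (mset_set (doubled_blocks X Y g h g' h' R))"
proof -
  let ?B = "doubled_blocks X Y g h g' h' R"
  have subset: "S \<subseteq> X \<union> Y" if "S \<in> ?B" for S
    using that by (auto simp: doubled_blocks_def crossing_blocks_def)
  have finB: "finite ?B" using subset fin by (intro finite_subset[of ?B "Pow (X \<union> Y)"]) auto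
  have card5: "card S = 5" if "S \<in> ?B" for S
  proof -
    have "S = (S \<inter> X) \<union> (S \<inter> Y)" using subset[OF that] by auto
    then have "card S = card (S \<inter> X) + card (S \<inter> Y)"
      using card_Un_disjoint[of "S \<inter> X" "S \<inter> Y"] fin disj by auto
    then show ?thesis using that by (auto simp: doubled_blocks_def crossing_blocks_def)
  qed
  have deg: "card {S \<in> ?B. T \<subseteq> S} = 3 * m * (m - 1)" if T: "T \<subseteq> X \<union> Y" "card T = 3" for T
  proof (cases "card (T \<inter> Y) \<le> 1")
    case True
    then show ?thesis
      using doubled_degree[OF fin disj card g h g' h' row col T] by simp
  next
    case False
    have "T = (T \<inter> X) \<union> (T \<inter> Y)" using T by auto
    then have "card T = card (T \<inter> X) + card (T \<inter> Y)"
      using card_Un_disjoint[of "T \<inter> X" "T \<inter> Y"] fin disj by auto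
    with False T have "card (T \<inter> X) \<le> 1" by simp
    then show ?thesis
      using doubled_degree[OF fin(2,1,3) _ card(2,1) g' h' g h row col _ T(2)] T(1) disj
      by (subst doubled_blocks_swap) (simp add: Un_commute Int_commute)
  qed
  show ?thesis
    unfolding simple_t_design_def t_design_def no_repeated_blocks_def
    using fin card disj subset card5 deg finB
    by (auto simp: card_Un_disjoint)
qed

section \<open>Colourings by sums modulo n\<close>

lemma affine_mod_reduce: "(k * (a mod n) + b) mod n = (k * a + b) mod n" for n :: int
proof -
  have "[k * (a mod n) + b = k * a + b] (mod n)"
    by (intro cong_add cong_mult cong_refl) (simp add: cong_def)
  then show ?thesis by (simp add: cong_def)
qed

lemma bij_betw_affine_mod:
  fixes n k b :: int
  assumes "n > 0" "coprime k n"
  shows "bij_betw (\<lambda>y. (k * y + b) mod n) {0..<n} {0..<n}"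
proof -
  have inj: "inj_on (\<lambda>y. (k * y + b) mod n) {0..<n}"
  proof (rule inj_onI)
    fix x y assume xy: "x \<in> {0..<n}" "y \<in> {0..<n}"
      and "(k * x + b) mod n = (k * y + b) mod n"
    then have "[k * x + b = k * y + b] (mod n)" by (simp add: cong_def)
    then have "[x = y] (mod n)"
      using assms by (simp add: cong_add_rcancel cong_mult_lcancel)
    then show "x = y" using xy by (simp add: cong_def)
  qed
  moreover have "(\<lambda>y. (k * y + b) mod n) ` {0..<n} \<subseteq> {0..<n}" using assms by auto
  ultimately show ?thesis
    unfolding bij_betw_def using endo_inj_surj[OF _ _ inj] by auto
qed

lemma affine_mod_solution:
  fixes n k b c :: int
  assumes "n > 0" "coprime k n" "c \<in> {0..<n}"
  obtains z where "z \<in> {0..<n}" "\<And>y. y \<in> {0..<n} \<Longrightarrow> (k * y + b) mod n = c \<longleftrightarrow> y = z"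
proof -
  note bij = bij_betw_affine_mod[OF assms(1,2), of b]
  have "c \<in> (\<lambda>y. (k * y + b) mod n) ` {0..<n}"
    using assms(3) bij_betw_imp_surj_on[OF bij] by simp
  then obtain z where z: "z \<in> {0..<n}" "c = (k * z + b) mod n" by (rule imageE)
  show ?thesis
  proof (rule that[OF z(1)])
    show "(k * y + b) mod n = c \<longleftrightarrow> y = z" if "y \<in> {0..<n}" for y
      using inj_on_eq_iff[OF bij_betw_imp_inj_on[OF bij] that z(1)] z(2) by simp
  qed
qed

text \<open>
  The partner of \<open>x\<close> must be \<open>c - x\<close>, which is a genuine partner unless it is \<open>x\<close> itself.
\<close>

lemma card_pairs_sum_through:
  fixes n c x :: int
  assumes "n > 0" "x \<in> {0..<n}" "c \<in> {0..<n}"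
  shows "card {P. P \<subseteq> {0..<n} \<and> card P = 2 \<and> x \<in> P \<and> \<Sum>P mod n = c} =
         (if 2 * x mod n = c then 0 else 1)"
proof -
  obtain z where z: "z \<in> {0..<n}" "\<And>y. y \<in> {0..<n} \<Longrightarrow> (1 * y + x) mod n = c \<longleftrightarrow> y = z"
    using affine_mod_solution[of n 1 c x] assms by auto
  have "card {P. P \<subseteq> {0..<n} \<and> card P = 2 \<and> x \<in> P \<and> \<Sum>P mod n = c} =
        card {y \<in> {0..<n} - {x}. \<Sum>{x, y} mod n = c}"
    using assms by (intro card_star_pairs) auto
  also have "{y \<in> {0..<n} - {x}. \<Sum>{x, y} mod n = c} = {z} - {x}"
  proof -
    have "\<Sum>{x, y} mod n = c \<longleftrightarrow> y = z" if "y \<in> {0..<n} - {x}" for y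
      using z(2)[of y] that by (simp add: add.commute)
    then show ?thesis using z(1) by blast
  qed
  also have "card ({z} - {x}) = (if 2 * x mod n = c then 0 else 1)"
    using z(2)[OF assms(2)] by auto
  finally show ?thesis .
qed

text \<open>
  The reflection \<open>x \<mapsto> c - x\<close> of the residues has exactly one fixed point when \<open>n\<close> is odd; the
  other \<open>2 m\<close> residues fall into \<open>m\<close> pairs.
\<close>

lemma card_pairs_sum:
  fixes m :: nat and c n :: int
  assumes "n = 2 * int m + 1" "c \<in> {0..<n}"
  shows "card {P. P \<subseteq> {0..<n} \<and> card P = 2 \<and> \<Sum>P mod n = c} = m"
proof -
  have n: "n > 0" "coprime 2 n" using assms by (simp_all add: coprime_left_2_iff_odd)
  obtain w where w: "w \<in> {0..<n}" "\<And>y. y \<in> {0..<n} \<Longrightarrow> (2 * y + 0) mod n = c \<longleftrightarrow> y = w"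
    using affine_mod_solution[OF n assms(2), of 0] by auto
  have "2 * card {P. P \<subseteq> {0..<n} \<and> card P = 2 \<and> \<Sum>P mod n = c} =
        (\<Sum>x\<in>{0..<n}. card {P \<in> {P. P \<subseteq> {0..<n} \<and> card P = 2 \<and> \<Sum>P mod n = c}. x \<in> P})"
    by (intro sum_degrees[symmetric]) auto
  also have "\<dots> = (\<Sum>x\<in>{0..<n}. if x \<noteq> w then 1 else 0)"
  proof (rule sum.cong)
    fix x assume x: "x \<in> {0..<n}"
    have "{P \<in> {P. P \<subseteq> {0..<n} \<and> card P = 2 \<and> \<Sum>P mod n = c}. x \<in> P} =
          {P. P \<subseteq> {0..<n} \<and> card P = 2 \<and> x \<in> P \<and> \<Sum>P mod n = c}" by auto
    then show "card {P \<in> {P. P \<subseteq> {0..<n} \<and> card P = 2 \<and> \<Sum>P mod n = c}. x \<in> P} =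
          (if x \<noteq> w then 1 else 0)"
      using card_pairs_sum_through[OF n(1) x assms(2)] w(2)[OF x] by simp
  qed simp
  also have "\<dots> = card ({0..<n} - {w})"
    by (simp add: sum.If_cases set_diff_eq Int_def)
  also have "\<dots> = 2 * m" using w assms by simp
  finally show ?thesis by simp
qed

text \<open>
  The extra point \<open>\<infinity>\<close> is represented by the integer \<open>n\<close>. Because \<open>n\<close> vanishes modulo \<open>n\<close>, it adds
  nothing to the sums, so only the factor in front depends on whether \<open>\<infinity>\<close> is present.
\<close>

definition pair_colour :: "int \<Rightarrow> int set \<Rightarrow> int" where
  "pair_colour n P = (if n \<in> P then 2 else 1) * \<Sum>P mod n"

text \<open>
  Six times the centre of gravity of the finite points: the factor is 2 for three of them and 3
  for two.
\<close>

definition triple_colour :: "int \<Rightarrow> int set \<Rightarrow> int" where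
  "triple_colour n T = (if n \<in> T then 3 else 2) * \<Sum>T mod n"

text \<open>
  The partner of a finite \<open>x\<close> in colour \<open>c\<close> is \<open>c - x\<close>; when this is \<open>x\<close>, then \<open>c = 2 x\<close>
  and \<open>\<infinity>\<close> takes its place.
\<close>

lemma pair_colour_balanced:
  fixes n :: int
  assumes n: "n > 0" "coprime 2 n"
  shows "balanced_colouring {0..n} {0..<n} 2 1 (pair_colour n)"
  unfolding balanced_colouring_def
proof (intro conjI ballI allI impI)
  show "pair_colour n S \<in> {0..<n}" for S using n by (simp add: pair_colour_def)
  fix x c assume x: "x \<in> {0..n}" and c: "c \<in> {0..<n}"
  have "card {S. S \<subseteq> {0..n} \<and> card S = 2 \<and> x \<in> S \<and> pair_colour n S = c} =
        card {y \<in> {0..n} - {x}. pair_colour n {x, y} = c}"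
    using x by (intro card_star_pairs) auto
  also have "\<dots> = 1"
  proof (cases "x = n")
    case True
    obtain w where w: "w \<in> {0..<n}" "\<And>y. y \<in> {0..<n} \<Longrightarrow> (2 * y + 2 * n) mod n = c \<longleftrightarrow> y = w"
      using affine_mod_solution[OF n c, of "2 * n"] by auto
    have "{y \<in> {0..n} - {x}. pair_colour n {x, y} = c} = {y \<in> {0..<n}. (2 * y + 2 * n) mod n = c}"
      using True by (auto simp: pair_colour_def algebra_simps)
    also have "\<dots> = {w}" using w by auto
    finally show ?thesis by simp
  next
    case False
    with x have x': "x \<in> {0..<n}" by auto
    obtain z where z: "z \<in> {0..<n}" "\<And>y. y \<in> {0..<n} \<Longrightarrow> (1 * y + x) mod n = c \<longleftrightarrow> y = z"
      using affine_mod_solution[of n 1 c x] n c by auto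
    have at_n: "pair_colour n {x, n} = 2 * x mod n"
      using False by (simp add: pair_colour_def distrib_left)
    have at_y: "pair_colour n {x, y} = (1 * y + x) mod n" if "y \<in> {0..<n}" "y \<noteq> x" for y
      using that x' by (auto simp: pair_colour_def add.commute)
    have "{y \<in> {0..n} - {x}. pair_colour n {x, y} = c} = (if z = x then {n} else {z})"
    proof -
      have "y \<in> {y \<in> {0..n} - {x}. pair_colour n {x, y} = c} \<longleftrightarrow>
            y \<in> (if z = x then {n} else {z})" for y
      proof (cases "y = n")
        case True
        then show ?thesis using at_n z(1) z(2)[OF x'] False n by auto
      next
        case False
        then show ?thesis using at_y[of y] z(1) z(2)[of y] x' by auto
      qed
      then show ?thesis by blast
    qed
    then show ?thesis by simp
  qed
  finally show "card {S. S \<subseteq> {0..n} \<and> card S = 2 \<and> x \<in> S \<and> pair_colour n S = c} = 1" .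
qed

text \<open>
  Deleting \<open>x\<close> from the triples through it leaves pairs of points. For finite \<open>x\<close> the number of
  finite pairs drops from \<open>m\<close> to \<open>m - 1\<close> exactly when one of the pairs with the required sum
  contains \<open>x\<close>, which happens exactly when \<open>x\<close> is not the centre of gravity \<open>c / 6\<close>. In that
  same case there is a triple \<open>{\<infinity>, x, y}\<close> of colour \<open>c\<close>, and it makes up for the loss.
\<close>

lemma triple_colour_balanced:
  fixes m :: nat and n :: int
  assumes nm: "n = 2 * int m + 1" and cop3: "coprime 3 n"
  shows "balanced_colouring {0..n} {0..<n} 3 m (triple_colour n)"
  unfolding balanced_colouring_def
proof (intro conjI ballI allI impI)
  have n: "n > 0" and cop2: "coprime 2 n"
    using nm by (simp_all add: coprime_left_2_iff_odd)
  show "triple_colour n S \<in> {0..<n}" for S using n by (simp add: triple_colour_def)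
  fix x c assume x: "x \<in> {0..n}" and c: "c \<in> {0..<n}"
  have link: "card {S. S \<subseteq> {0..n} \<and> card S = 3 \<and> x \<in> S \<and> triple_colour n S = c} =
        card {P. P \<subseteq> {0..n} - {x} \<and> card P = 2 \<and> triple_colour n (insert x P) = c}"
    using card_star[of "{0..n}" x 2 "\<lambda>S. triple_colour n S = c"] x
    by (simp add: numeral_3_eq_3 numeral_2_eq_2)
  have fin2: "finite P" if "card P = 2" for P :: "int set"
    using that card_gt_0_iff[of P] by simp
  show "card {S. S \<subseteq> {0..n} \<and> card S = 3 \<and> x \<in> S \<and> triple_colour n S = c} = m"
  proof (cases "x = n")
    case True
    obtain w where w: "w \<in> {0..<n}" "\<And>y. y \<in> {0..<n} \<Longrightarrow> (3 * y + 0) mod n = c \<longleftrightarrow> y = w"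
      using affine_mod_solution[OF n cop3 c, of 0] by auto
    have col: "triple_colour n (insert x P) = c \<longleftrightarrow> \<Sum>P mod n = w"
      if "P \<subseteq> {0..<n}" "card P = 2" for P
    proof -
      have "n \<notin> P" using that by auto
      then have "triple_colour n (insert x P) = (3 * \<Sum>P + 3 * n) mod n"
        using True fin2[OF that(2)] by (simp add: triple_colour_def algebra_simps)
      also have "\<dots> = (3 * (\<Sum>P mod n) + 0) mod n" by (simp add: mod_mult_right_eq)
      finally show ?thesis using w(2)[of "\<Sum>P mod n"] n by simp
    qed
    have "{0..n} - {x} = {0..<n}" using True by auto
    then have "{P. P \<subseteq> {0..n} - {x} \<and> card P = 2 \<and> triple_colour n (insert x P) = c} =
          {P. P \<subseteq> {0..<n} \<and> card P = 2 \<and> \<Sum>P mod n = w}"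
      using col by auto
    then show ?thesis using link card_pairs_sum[OF nm w(1)] by simp
  next
    case False
    with x have x': "x \<in> {0..<n}" by auto
    obtain d where d: "d \<in> {0..<n}"
      "\<And>y. y \<in> {0..<n} \<Longrightarrow> (2 * y + 2 * x) mod n = c \<longleftrightarrow> y = d"
      using affine_mod_solution[OF n cop2 c, of "2 * x"] by auto
    obtain e where e: "e \<in> {0..<n}"
      "\<And>y. y \<in> {0..<n} \<Longrightarrow> (3 * y + 3 * x) mod n = c \<longleftrightarrow> y = e"
      using affine_mod_solution[OF n cop3 c, of "3 * x"] by auto
    \<comment> \<open>Two finite points completing \<open>x\<close> must have sum \<open>d\<close>, and \<open>e\<close> is the point completing
      \<open>\<infinity>\<close> and \<open>x\<close>. Each side of the equivalence says that \<open>x\<close> is the centre, \<open>6 x = c\<close>.\<close>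
    have de: "2 * x mod n = d \<longleftrightarrow> e = x"
    proof -
      have "(2 * (2 * x mod n) + 2 * x) mod n = (3 * x + 3 * x) mod n"
        unfolding affine_mod_reduce by simp
      then show ?thesis using d(2)[of "2 * x mod n"] e(2)[OF x'] n by auto
    qed
    define L where "L = {P. P \<subseteq> {0..n} - {x} \<and> card P = 2 \<and> triple_colour n (insert x P) = c}"
    define L1 where "L1 = {P \<in> L. n \<in> P}"
    define L0 where "L0 = {P \<in> L. n \<notin> P}"
    have "finite L" unfolding L_def by simp
    have "card L = card L1 + card L0"
    proof -
      have "L = L1 \<union> L0" by (auto simp: L1_def L0_def)
      then show ?thesis
        using \<open>finite L\<close> card_Un_disjoint[of L1 L0] by (auto simp: L1_def L0_def)
    qed
    moreover have "card L1 = (if e = x then 0 else 1)"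
    proof -
      have "L1 = {P. P \<subseteq> {0..n} - {x} \<and> card P = 2 \<and> n \<in> P \<and> triple_colour n (insert x P) = c}"
        by (auto simp: L1_def L_def)
      also have "card \<dots> =
          card {y \<in> {0..n} - {x} - {n}. triple_colour n (insert x {n, y}) = c}"
        using False n by (intro card_star_pairs) auto
      also have "{y \<in> {0..n} - {x} - {n}. triple_colour n (insert x {n, y}) = c} = {e} - {x}"
      proof -
        have "triple_colour n (insert x {n, y}) = c \<longleftrightarrow> y = e"
          if "y \<in> {0..<n} - {x}" for y
        proof -
          have "triple_colour n (insert x {n, y}) = (3 * y + 3 * x + 3 * n) mod n"
            using that x' by (simp add: triple_colour_def algebra_simps)
          then show ?thesis using e(2)[of y] that by simp
        qed
        moreover have "{0..n} - {x} - {n} = {0..<n} - {x}" by auto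
        ultimately show ?thesis using e(1) by blast
      qed
      finally show ?thesis by simp
    qed
    moreover have "card L0 + (if 2 * x mod n = d then 0 else 1) = m"
    proof -
      define Q where "Q = {P. P \<subseteq> {0..<n} \<and> card P = 2 \<and> \<Sum>P mod n = d}"
      have "finite Q" unfolding Q_def by simp
      have col: "triple_colour n (insert x P) = c \<longleftrightarrow> \<Sum>P mod n = d"
        if "P \<subseteq> {0..<n} - {x}" "card P = 2" for P
      proof -
        have "n \<notin> {0..<n}" by simp
        then have "n \<notin> insert x P" "x \<notin> P" using that(1) x' by blast+
        then have "triple_colour n (insert x P) = (2 * \<Sum>P + 2 * x) mod n"
          using fin2[OF that(2)] by (simp add: triple_colour_def distrib_left add.commute)
        also have "\<dots> = (2 * (\<Sum>P mod n) + 2 * x) mod n"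
          by (rule affine_mod_reduce[symmetric])
        finally show ?thesis using d(2)[of "\<Sum>P mod n"] n by simp
      qed
      have "L0 = {P \<in> Q. x \<notin> P}"
      proof -
        have "{0..n} - {x} - {n} = {0..<n} - {x}" by auto
        moreover have "P \<subseteq> Z \<and> n \<notin> P \<longleftrightarrow> P \<subseteq> Z - {n}" for P Z by blast
        ultimately have "P \<subseteq> {0..n} - {x} \<and> n \<notin> P \<longleftrightarrow> P \<subseteq> {0..<n} - {x}" for P
          by (simp only:)
        then have "L0 = {P. P \<subseteq> {0..<n} - {x} \<and> card P = 2 \<and> triple_colour n (insert x P) = c}"
          unfolding L0_def L_def by blast
        also have "\<dots> = {P. P \<subseteq> {0..<n} - {x} \<and> card P = 2 \<and> \<Sum>P mod n = d}"
          using col by blast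
        also have "\<dots> = {P \<in> Q. x \<notin> P}" unfolding Q_def by blast
        finally show ?thesis .
      qed
      moreover have "card Q = card {P \<in> Q. x \<notin> P} + card {P \<in> Q. x \<in> P}"
      proof -
        have "Q = {P \<in> Q. x \<notin> P} \<union> {P \<in> Q. x \<in> P}" by auto
        then show ?thesis
          using \<open>finite Q\<close> card_Un_disjoint[of "{P \<in> Q. x \<notin> P}" "{P \<in> Q. x \<in> P}"] by auto
      qed
      moreover have "card {P \<in> Q. x \<in> P} = (if 2 * x mod n = d then 0 else 1)"
        using card_pairs_sum_through[OF n x' d(1)] by (simp add: Q_def conj_ac)
      moreover have "card Q = m" using card_pairs_sum[OF nm d(1)] by (simp add: Q_def)
      ultimately show ?thesis by simp
    qed
    ultimately have "card L = m" using de by (auto split: if_splits)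
    then show ?thesis using link by (simp add: L_def)
  qed
qed

lemma card_shift_mod_less:
  fixes n c :: int
  assumes "n > 0" "int u \<le> n"
  shows "card {d \<in> {0..<n}. (c + d) mod n < int u} = u"
proof -
  have bij: "bij_betw (\<lambda>d. (1 * d + c) mod n) {0..<n} {0..<n}"
    using assms by (intro bij_betw_affine_mod) auto
  have "bij_betw (\<lambda>d. (1 * d + c) mod n) {d \<in> {0..<n}. (c + d) mod n < int u} {0..<int u}"
    unfolding bij_betw_def
  proof
    show "inj_on (\<lambda>d. (1 * d + c) mod n) {d \<in> {0..<n}. (c + d) mod n < int u}"
      using bij by (auto simp: bij_betw_def intro: inj_on_subset)
    show "(\<lambda>d. (1 * d + c) mod n) ` {d \<in> {0..<n}. (c + d) mod n < int u} = {0..<int u}"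
    proof (intro equalityI subsetI)
      fix e assume e: "e \<in> {0..<int u}"
      with assms have "e \<in> {0..<n}" by auto
      then have "e \<in> (\<lambda>d. (1 * d + c) mod n) ` {0..<n}"
        using bij_betw_imp_surj_on[OF bij] by simp
      then obtain d where "d \<in> {0..<n}" "e = (1 * d + c) mod n" by (rule imageE)
      then show "e \<in> (\<lambda>d. (1 * d + c) mod n) ` {d \<in> {0..<n}. (c + d) mod n < int u}"
        using e by (intro image_eqI[of _ _ d]) (auto simp: add.commute)
    qed (use assms in \<open>auto simp: add.commute\<close>)
  qed
  then show ?thesis using bij_betw_same_card by fastforce
qed

theorem theorem3p1:
  fixes v :: nat
  assumes "v > 5" and "v mod 6 = 2"
  shows "\<exists>(X :: nat set) \<B> lam.
           real lam = 3 / 4 * (real v - 2) * (real v - 4) \<and>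
           simple_t_design 3 (2 * v) 5 lam X \<B>"
proof -
  define m where "m = (v - 2) div 2"
  have v: "v = 2 * m + 2" and m: "m \<ge> 1" using assms unfolding m_def by presburger+
  define n where "n = 2 * int m + 1"
  have n: "n > 0" "coprime 2 n" by (simp_all add: n_def coprime_left_2_iff_odd)
  have "\<not> 3 dvd n" using assms unfolding n_def v by presburger
  then have cop3: "coprime 3 n" by (intro prime_imp_coprime) auto
  \<comment> \<open>A Cayley-type relation on the residues: any set of \<open>m - 1\<close> admissible sums makes every
    colour have exactly \<open>m - 1\<close> partners; an initial interval is one choice.\<close>
  define R where "R = {(c, d). (c + d) mod n < int (m - 1)}"
  have row: "card {d \<in> {0..<n}. (c, d) \<in> R} = m - 1" for c
    using card_shift_mod_less[OF n(1), of "m - 1" c] by (simp add: R_def n_def)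
  have col: "card {c \<in> {0..<n}. (c, d) \<in> R} = m - 1" for d
    using card_shift_mod_less[OF n(1), of "m - 1" d] by (simp add: R_def n_def add.commute)
  define X Y where "X = {0..<v}" and "Y = {v..<2 * v}"
  have XY: "finite X" "finite Y" "X \<inter> Y = {}" "card X = 2 * m + 2" "card Y = 2 * m + 2"
    by (auto simp: X_def Y_def v)
  have "card {0..n} = 2 * m + 2" by (simp add: n_def)
  then obtain \<phi> \<psi> where "bij_betw \<phi> X {0..n}" "bij_betw \<psi> Y {0..n}"
    using finite_same_card_bij[of X "{0..n}"] finite_same_card_bij[of Y "{0..n}"] XY by auto
  then have
    "simple_t_design 3 (2 * (2 * m + 2)) 5 (3 * m * (m - 1)) (X \<union> Y)
       (mset_set (doubled_blocks X Y
          (\<lambda>S. triple_colour n (\<phi> ` S)) (\<lambda>S. pair_colour n (\<psi> ` S))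
          (\<lambda>S. triple_colour n (\<psi> ` S)) (\<lambda>S. pair_colour n (\<phi> ` S)) R))"
    using XY row col pair_colour_balanced[OF n] triple_colour_balanced[OF n_def cop3]
    by (intro doubled_design[where C = "{0..<n}"] balanced_colouring_transfer) auto
  moreover have "real (3 * m * (m - 1)) = 3 / 4 * (real v - 2) * (real v - 4)"
    using m by (simp add: v of_nat_diff algebra_simps)
  ultimately show ?thesis unfolding v by blast
qed

end
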